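(* Let $\Omega\subset\mathbb{R}^n$, $(T_\varepsilon)_{\varepsilon\in(-\varepsilon_0,\varepsilon_0)}$, $a_\varepsilon$ and $\dot a_0$ be as in the context, and let $H$ be $H^1(\Omega)$ (Neumann case) or $H_0^1(\Omega)$ (Dirichlet case). Then the bilinear form $\dot a_0$ is a weak derivative at $\varepsilon=0$ of the weak form of the dynamic Laplacian, in the sense that for all $\psi,\varphi\in H$ $$\dot a_0(\psi,\varphi)=\lim_{\varepsilon\to0}\frac{a_\varepsilon(\psi,\varphi)-a_0(\psi,\varphi)}{\varepsilon}.$$
   Context: Standing setting. $\Omega\subset\mathbb{R}^n$ is a compact, connected domain with smooth boundary. For $\varepsilon\in(-\varepsilon_0,\varepsilon_0)$, $T_\varepsilon:\Omega\to T_\varepsilon(\Omega)\subset\mathbb{R}^n$ is a volume-preserving $C^2$-diffeomorphism onto its image, and $\varepsilon\mapsto T_\varepsilon$ is $C^1$ with respect to the $C^2(\Omega,\mathbb{R}^n)$-norm; $\dot T_0\in C^2(\Omega,\mathbb{R}^n)$ denotes its derivative at $\varepsilon=0$. $\ell$ is Lebesgue measure. Put $A_\varepsilon:=\frac12\left(I+(DT_\varepsilon^\top DT_\varepsilon)^{-1}\right)$. The dynamic Laplacian is $\Delta^D_\varepsilon u=\frac12\left(\Delta u+\left(\Delta (u\circ T_\varepsilon^{-1})\right)\circ T_\varepsilon\right)=\mathrm{div}(A_\varepsilon\nabla u)$, with associated bilinear form $a_\varepsilon(\psi,\varphi):=\int_\Omega A_\varepsilon\nabla\psi\cdot\nabla\varphi\,d\ell$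 on $H$. With $Q^{\mathrm{sym}}=\frac12(Q+Q^\top)$, put $\dot A_0:=-\left((DT_0)^{-1}(D\dot T_0)(DT_0)^{-1}(DT_0)^{-\top}\right)^{\mathrm{sym}}$ and $\dot a_0(\psi,\varphi):=\int_\Omega\dot A_0\nabla\psi\cdot\nabla\varphi\,d\ell$. *)

theory Defs
  imports "HOL-Analysis.Analysis"
begin

definition partial_within ::
    "'a::euclidean_space set \<Rightarrow> 'a \<Rightarrow> ('a \<Rightarrow> 'b::real_normed_vector) \<Rightarrow> 'a \<Rightarrow> 'b" where
  "partial_within S v f x = frechet_derivative f (at x within S) v"

text \<open>
  Differentiability of class \<open>C\<^sup>k\<close> on \<open>S\<close>, including at points of \<open>S\<close> that lie on its boundary,
  by means of derivatives within \<open>S\<close>. This is meant only for sets on which such derivatives are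
  unique at every point: open sets, compact domains with smooth boundary, and images of the latter
  under diffeomorphisms. For these domains it is the usual space of functions that are \<open>C\<^sup>k\<close> in the
  interior with all partial derivatives extending continuously up to the boundary. Only the values
  of \<open>f\<close> on \<open>S\<close> matter.
\<close>

fun Ck_on :: "nat \<Rightarrow> 'a::euclidean_space set \<Rightarrow> ('a \<Rightarrow> 'b::real_normed_vector) \<Rightarrow> bool" where
  "Ck_on 0 S f \<longleftrightarrow> continuous_on S f"
| "Ck_on (Suc k) S f \<longleftrightarrow>
     f differentiable_on S \<and> (\<forall>v\<in>Basis. Ck_on k S (partial_within S v f))"

definition smooth_on :: "'a::euclidean_space set \<Rightarrow> ('a \<Rightarrow> 'b::real_normed_vector) \<Rightarrow> bool" where
  "smooth_on S f \<longleftrightarrow> (\<forall>k. Ck_on k S f)"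

text \<open>
  The sum of the suprema of all iterated partial derivatives of order at most \<open>k\<close>. Mixed partial
  derivatives occur once for each order of differentiation, which gives a norm equivalent to the
  other customary choices. The suprema are finite for \<open>f\<close> of class \<open>C\<^sup>k\<close> on a nonempty compact \<open>S\<close>.
\<close>

fun Ck_norm :: "nat \<Rightarrow> 'a::euclidean_space set \<Rightarrow> ('a \<Rightarrow> 'b::real_normed_vector) \<Rightarrow> real" where
  "Ck_norm 0 S f = (SUP x\<in>S. norm (f x))"
| "Ck_norm (Suc k) S f =
     (SUP x\<in>S. norm (f x)) + (\<Sum>v\<in>Basis. Ck_norm k S (partial_within S v f))"

text \<open>
  Near each boundary point, \<open>\<Omega>\<close> is the sublevel set of a smooth function without critical points.
\<close>

definition smooth_boundary :: "'a::euclidean_space set \<Rightarrow> bool" where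
  "smooth_boundary \<Omega> \<longleftrightarrow>
     (\<forall>p\<in>frontier \<Omega>. \<exists>U (g :: 'a \<Rightarrow> real).
        open U \<and> p \<in> U \<and> smooth_on U g \<and>
        (\<forall>x\<in>U. frechet_derivative g (at x) \<noteq> (\<lambda>_. 0)) \<and>
        \<Omega> \<inter> U = {x \<in> U. g x \<le> 0})"

definition Ck_diffeo_onto_image ::
    "nat \<Rightarrow> 'a::euclidean_space set \<Rightarrow> ('a \<Rightarrow> 'a) \<Rightarrow> bool" where
  "Ck_diffeo_onto_image k \<Omega> T \<longleftrightarrow>
     inj_on T \<Omega> \<and> Ck_on k \<Omega> T \<and> Ck_on k (T ` \<Omega>) (inv_into \<Omega> T)"

definition volume_preserving :: "'a::euclidean_space set \<Rightarrow> ('a \<Rightarrow> 'a) \<Rightarrow> bool" where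
  "volume_preserving \<Omega> T \<longleftrightarrow>
     (\<forall>S\<in>sets lebesgue. S \<subseteq> \<Omega> \<longrightarrow>
        T ` S \<in> sets lebesgue \<and> emeasure lebesgue (T ` S) = emeasure lebesgue S)"

text \<open>
  The curve \<open>\<epsilon> \<mapsto> T \<epsilon>\<close>, for \<open>\<epsilon>\<close> in the open interval \<open>I\<close>, takes values in \<open>C\<^sup>k(\<Omega>)\<close> and is
  continuously differentiable in the \<open>C\<^sup>k\<close> norm, with derivative \<open>T'\<close>.
\<close>

definition C1_curve_in_Ck ::
    "nat \<Rightarrow> 'a::euclidean_space set \<Rightarrow> real set
      \<Rightarrow> (real \<Rightarrow> 'a \<Rightarrow> 'b::real_normed_vector) \<Rightarrow> (real \<Rightarrow> 'a \<Rightarrow> 'b) \<Rightarrow> bool" where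
  "C1_curve_in_Ck k \<Omega> I T T' \<longleftrightarrow>
     (\<forall>\<epsilon>\<in>I. Ck_on k \<Omega> (T \<epsilon>) \<and> Ck_on k \<Omega> (T' \<epsilon>) \<and>
        ((\<lambda>\<delta>. Ck_norm k \<Omega> (\<lambda>x. (T \<delta> x - T \<epsilon> x) /\<^sub>R (\<delta> - \<epsilon>) - T' \<epsilon> x)) \<longlongrightarrow> 0) (at \<epsilon>) \<and>
        ((\<lambda>\<delta>. Ck_norm k \<Omega> (\<lambda>x. T' \<delta> x - T' \<epsilon> x)) \<longlongrightarrow> 0) (at \<epsilon>))"

text \<open>
  Elements of the Lebesgue and Sobolev spaces are represented by functions rather than by classes of
  almost everywhere equal functions; their values outside \<open>\<Omega>\<close> are irrelevant.
\<close>

definition L2 :: "'a::euclidean_space set \<Rightarrow> ('a \<Rightarrow> 'b::euclidean_space) set" where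
  "L2 \<Omega> = {f. f \<in> borel_measurable (lebesgue_on \<Omega>) \<and>
               integrable (lebesgue_on \<Omega>) (\<lambda>x. (norm (f x))\<^sup>2)}"

definition test_functions :: "'a::euclidean_space set \<Rightarrow> ('a \<Rightarrow> real) set" where
  "test_functions \<Omega> = {\<eta>. smooth_on UNIV \<eta> \<and> compact (closure {x. \<eta> x \<noteq> 0}) \<and>
                           closure {x. \<eta> x \<noteq> 0} \<subseteq> interior \<Omega>}"

definition is_weak_gradient ::
    "(real ^ 'n) set \<Rightarrow> (real ^ 'n \<Rightarrow> real) \<Rightarrow> (real ^ 'n \<Rightarrow> real ^ 'n) \<Rightarrow> bool" where
  "is_weak_gradient \<Omega> u G \<longleftrightarrow>
     (\<forall>\<eta>\<in>test_functions \<Omega>. \<forall>i.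
        (LINT x|lebesgue_on \<Omega>. u x * partial_within UNIV (axis i 1) \<eta> x) =
        - (LINT x|lebesgue_on \<Omega>. G x $ i * \<eta> x))"

definition H1 :: "(real ^ 'n) set \<Rightarrow> (real ^ 'n \<Rightarrow> real) set" where
  "H1 \<Omega> = {u \<in> L2 \<Omega>. \<exists>G\<in>L2 \<Omega>. is_weak_gradient \<Omega> u G}"

text \<open>
  The weak gradient is unique up to null sets, so the choice does not affect integrals.
\<close>

definition weak_gradient ::
    "(real ^ 'n) set \<Rightarrow> (real ^ 'n \<Rightarrow> real) \<Rightarrow> real ^ 'n \<Rightarrow> real ^ 'n" where
  "weak_gradient \<Omega> u = (SOME G. G \<in> L2 \<Omega> \<and> is_weak_gradient \<Omega> u G)"

definition H1_norm :: "(real ^ 'n) set \<Rightarrow> (real ^ 'n \<Rightarrow> real) \<Rightarrow> real" where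
  "H1_norm \<Omega> u =
     sqrt ((LINT x|lebesgue_on \<Omega>. (u x)\<^sup>2) +
           (LINT x|lebesgue_on \<Omega>. (norm (weak_gradient \<Omega> u x))\<^sup>2))"

definition H1_0 :: "(real ^ 'n) set \<Rightarrow> (real ^ 'n \<Rightarrow> real) set" where
  "H1_0 \<Omega> = {u \<in> H1 \<Omega>. \<exists>\<eta>. (\<forall>k. \<eta> k \<in> test_functions \<Omega>) \<and>
                 (\<lambda>k::nat. H1_norm \<Omega> (\<lambda>x. u x - \<eta> k x)) \<longlonglongrightarrow> 0}"

definition jacobian_on ::
    "(real ^ 'n) set \<Rightarrow> (real ^ 'n \<Rightarrow> real ^ 'n) \<Rightarrow> real ^ 'n \<Rightarrow> real ^ 'n ^ 'n" where
  "jacobian_on \<Omega> T x = jacobian T (at x within \<Omega>)"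

definition sym_part :: "real ^ 'n ^ 'n \<Rightarrow> real ^ 'n ^ 'n" where
  "sym_part Q = (1 / 2) *\<^sub>R (Q + transpose Q)"

definition dyn_matrix ::
    "(real ^ 'n) set \<Rightarrow> (real ^ 'n \<Rightarrow> real ^ 'n) \<Rightarrow> real ^ 'n \<Rightarrow> real ^ 'n ^ 'n" where
  "dyn_matrix \<Omega> T x =
     (1 / 2) *\<^sub>R (mat 1 + matrix_inv (transpose (jacobian_on \<Omega> T x) ** jacobian_on \<Omega> T x))"

definition dyn_matrix_deriv ::
    "(real ^ 'n) set \<Rightarrow> (real ^ 'n \<Rightarrow> real ^ 'n) \<Rightarrow> (real ^ 'n \<Rightarrow> real ^ 'n)
      \<Rightarrow> real ^ 'n \<Rightarrow> real ^ 'n ^ 'n" where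
  "dyn_matrix_deriv \<Omega> T T' x =
     - sym_part (matrix_inv (jacobian_on \<Omega> T x) ** jacobian_on \<Omega> T' x **
                 matrix_inv (jacobian_on \<Omega> T x) ** transpose (matrix_inv (jacobian_on \<Omega> T x)))"

definition gradient_form ::
    "(real ^ 'n) set \<Rightarrow> (real ^ 'n \<Rightarrow> real ^ 'n ^ 'n)
      \<Rightarrow> (real ^ 'n \<Rightarrow> real) \<Rightarrow> (real ^ 'n \<Rightarrow> real) \<Rightarrow> real" where
  "gradient_form \<Omega> A \<psi> \<phi> =
     (LINT x|lebesgue_on \<Omega>. (A x *v weak_gradient \<Omega> \<psi> x) \<bullet> weak_gradient \<Omega> \<phi> x)"

text \<open>
  For volume-preserving \<open>T\<close>, the dynamic Laplacian \<open>u \<mapsto> (\<Delta>u + \<Delta>(u \<circ> T\<^sup>-\<^sup>1) \<circ> T) / 2\<close> equals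
  \<open>u \<mapsto> div (A \<nabla>u)\<close> with \<open>A = dyn_matrix \<Omega> T\<close>; its bilinear form is the following one, with the
  sign convention that makes it positive.
\<close>

definition dyn_form ::
    "(real ^ 'n) set \<Rightarrow> (real ^ 'n \<Rightarrow> real ^ 'n)
      \<Rightarrow> (real ^ 'n \<Rightarrow> real) \<Rightarrow> (real ^ 'n \<Rightarrow> real) \<Rightarrow> real" where
  "dyn_form \<Omega> T = gradient_form \<Omega> (dyn_matrix \<Omega> T)"

definition dyn_form_deriv ::
    "(real ^ 'n) set \<Rightarrow> (real ^ 'n \<Rightarrow> real ^ 'n) \<Rightarrow> (real ^ 'n \<Rightarrow> real ^ 'n)
      \<Rightarrow> (real ^ 'n \<Rightarrow> real) \<Rightarrow> (real ^ 'n \<Rightarrow> real) \<Rightarrow> real" where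
  "dyn_form_deriv \<Omega> T T' = gradient_form \<Omega> (dyn_matrix_deriv \<Omega> T T')"

end

theory Submission
  imports Defs
begin

text \<open>
  Convergence of \<open>(T \<epsilon> - T 0) / \<epsilon>\<close> in the \<open>C\<^sup>2\<close> norm makes the difference quotients of the Jacobians
  converge uniformly on \<open>\<Omega>\<close>. The Jacobian of \<open>T 0\<close> is invertible by the chain rule, and its inverse
  is bounded by compactness, so the identity \<open>A\<^sup>-\<^sup>1 - B\<^sup>-\<^sup>1 = - A\<^sup>-\<^sup>1 (A - B) B\<^sup>-\<^sup>1\<close> carries uniform convergence
  over to the inverse Jacobians and to the matrices \<open>A\<^sub>\<epsilon>\<close>. A uniformly convergent coefficient
  matrix may be taken to the limit under the integral against two square integrable gradients.
\<close>

section \<open>Derivatives within domains with smooth boundary\<close>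

text \<open>
  At every point of \<open>S\<close>, an open set of directions points into \<open>S\<close>; being open, it spans the
  space. This makes derivatives within \<open>S\<close> unique also at boundary points, where the rules for
  \<open>frechet_derivative\<close> within \<open>S\<close> are otherwise unavailable.
\<close>

definition has_inner_cones :: "'a::real_normed_vector set \<Rightarrow> bool" where
  "has_inner_cones S \<longleftrightarrow>
     (\<forall>x\<in>S. \<exists>U. open U \<and> U \<noteq> {} \<and> (\<forall>w\<in>U. \<forall>\<^sub>F t in at_right 0. x + t *\<^sub>R w \<in> S))"

text \<open>At interior points every direction points inward. At a frontier point with local
  defining function \<open>g\<close> and \<open>L\<close> its derivative there, the directions with
  \<open>L w < 0\<close> form an open half space, nonempty because \<open>L\<close> does not vanish;
  along them \<open>g\<close> drops below its value at the point.\<close>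

lemma has_inner_cones_smooth_boundary:
  fixes \<Omega> :: "'a::euclidean_space set"
  assumes sb: "smooth_boundary \<Omega>"
  shows "has_inner_cones \<Omega>"
  unfolding has_inner_cones_def
proof
  fix p assume p: "p \<in> \<Omega>"
  have lim: "((\<lambda>t. p + t *\<^sub>R w) \<longlongrightarrow> p) (at_right 0)" for w :: 'a
    by (auto intro!: tendsto_eq_intros)
  show "\<exists>U. open U \<and> U \<noteq> {} \<and> (\<forall>w\<in>U. \<forall>\<^sub>F t in at_right 0. p + t *\<^sub>R w \<in> \<Omega>)"
  proof (cases "p \<in> interior \<Omega>")
    case True
    have "\<forall>\<^sub>F t in at_right 0. p + t *\<^sub>R w \<in> \<Omega>" for w
      using topological_tendstoD[OF lim open_interior True]
      by (rule eventually_mono) (use interior_subset in blast)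
    then show ?thesis by (intro exI[of _ UNIV]) auto
  next
    case False
    with p have "p \<in> frontier \<Omega>"
      using closure_subset by (auto simp: frontier_def)
    then obtain V and g :: "'a \<Rightarrow> real" where V: "open V" "p \<in> V" and g: "smooth_on V g"
      and crit: "\<forall>x\<in>V. frechet_derivative g (at x) \<noteq> (\<lambda>_. 0)"
      and sub: "\<Omega> \<inter> V = {x \<in> V. g x \<le> 0}"
      using sb unfolding smooth_boundary_def by blast
    define L where "L = frechet_derivative g (at p)"
    have "g differentiable_on V"
      using g unfolding smooth_on_def by (metis Ck_on.simps(2))
    then have "g differentiable (at p)"
      using V by (metis at_within_open differentiable_on_def)
    then have der: "(g has_derivative L) (at p)"
      unfolding L_def by (simp add: frechet_derivative_works)
    then interpret L: bounded_linear L by (rule has_derivative_bounded_linear)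
    obtain w0 where "L w0 \<noteq> 0" using crit V(2) unfolding L_def by blast
    then have "L w0 < 0 \<or> L (- w0) < 0" using linear_neg[OF L.linear] by fastforce
    then have ne: "{w. L w < 0} \<noteq> {}" by blast
    have op: "open {w. L w < 0}"
      by (intro open_Collect_less continuous_intros L.continuous_on)
    have "\<forall>\<^sub>F t in at_right 0. p + t *\<^sub>R w \<in> \<Omega>" if w: "L w < 0" for w
    proof -
      have "((\<lambda>t. p + t *\<^sub>R w) has_derivative (\<lambda>t. t *\<^sub>R w)) (at 0)"
        by (auto intro!: derivative_eq_intros)
      moreover have "(g has_derivative L) (at (p + 0 *\<^sub>R w))" using der by simp
      ultimately have "((\<lambda>t. g (p + t *\<^sub>R w)) has_derivative (\<lambda>t. L (t *\<^sub>R w))) (at 0)"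
        by (rule has_derivative_compose)
      then have "((\<lambda>t. g (p + t *\<^sub>R w)) has_real_derivative L w) (at 0)"
        by (simp add: has_field_derivative_def L.scaleR mult_commute_abs)
      from DERIV_neg_dec_right[OF this w] obtain d where d: "d > 0"
        "\<And>h. h > 0 \<Longrightarrow> h < d \<Longrightarrow> g (p + h *\<^sub>R w) < g p" by auto
      \<comment> \<open>The bound \<open>g p \<le> 0\<close> is enough, since \<open>g\<close>
        decreases strictly along \<open>w\<close>; \<open>g p = 0\<close> need not be
        established.\<close>
      have "g p \<le> 0" using p V sub by auto
      have "\<forall>\<^sub>F t in at_right 0. p + t *\<^sub>R w \<in> V"
        by (rule topological_tendstoD[OF lim V])
      moreover have "\<forall>\<^sub>F t in at_right 0. g (p + t *\<^sub>R w) < g p"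
        using d by (auto simp: eventually_at_right_field)
      moreover have "y \<in> \<Omega>" if "y \<in> V" "g y < g p" for y
      proof -
        have "y \<in> {x \<in> V. g x \<le> 0}" using that \<open>g p \<le> 0\<close> by simp
        then show ?thesis using sub by blast
      qed
      ultimately show ?thesis by (rule eventually_elim2)
    qed
    then show ?thesis using op ne by blast
  qed
qed

text \<open>Along an inner direction both maps give the one-sided derivative of \<open>f\<close> on
  a ray inside \<open>S\<close>, so they agree on the open set \<open>U\<close>. Linear maps
  agreeing on a nonempty open set are equal.\<close>

lemma has_derivative_unique_inner_cones:
  assumes S: "has_inner_cones S" "x \<in> S"
    and f: "(f has_derivative D1) (at x within S)" "(f has_derivative D2) (at x within S)"
  shows "D1 = D2"
proof -
  obtain U where U: "open U" "U \<noteq> {}" and cone: "\<forall>w\<in>U. \<forall>\<^sub>F t in at_right 0. x + t *\<^sub>R w \<in> S"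
    using bspec[OF S(1)[unfolded has_inner_cones_def] S(2)] by auto
  interpret D1: bounded_linear D1 using f(1) by (rule has_derivative_bounded_linear)
  interpret D2: bounded_linear D2 using f(2) by (rule has_derivative_bounded_linear)
  have eq: "D1 w = D2 w" if w: "w \<in> U" for w
  proof -
    obtain b where b: "b > 0" "\<And>t. 0 < t \<Longrightarrow> t < b \<Longrightarrow> x + t *\<^sub>R w \<in> S"
      using bspec[OF cone w] by (auto simp: eventually_at_right_field)
    \<comment> \<open>The ray is known to lie in \<open>S\<close> only for parameters strictly below
      \<open>b\<close>, hence the half; \<open>0\<close> is included because \<open>x\<close> itself
      lies in \<open>S\<close>. The filter at \<open>0\<close> within \<open>R\<close> is the
      nontrivial right-sided one, so vector derivatives there are unique.\<close>
    define R where "R = {0..b / 2}"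
    have im: "(\<lambda>t. x + t *\<^sub>R w) ` R \<subseteq> S"
      using b S(2) by (auto simp: R_def le_less)
    have vd: "((\<lambda>t. f (x + t *\<^sub>R w)) has_vector_derivative D w) (at 0 within R)"
      if D: "(f has_derivative D) (at x within S)" for D
    proof -
      interpret D: bounded_linear D using D by (rule has_derivative_bounded_linear)
      have "(f has_derivative D) (at (x + 0 *\<^sub>R w) within (\<lambda>t. x + t *\<^sub>R w) ` R)"
        using has_derivative_subset[OF D im] by simp
      moreover have "((\<lambda>t. x + t *\<^sub>R w) has_derivative (\<lambda>t. t *\<^sub>R w)) (at 0 within R)"
        by (auto intro!: derivative_eq_intros)
      ultimately have "(f \<circ> (\<lambda>t. x + t *\<^sub>R w) has_derivative D \<circ> (\<lambda>t. t *\<^sub>R w)) (at 0 within R)"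
        by (rule diff_chain_within[rotated])
      then show ?thesis
        by (simp add: has_vector_derivative_def D.scaleR o_def)
    qed
    have "at 0 within R = at_right 0"
      unfolding R_def using b(1) by (intro at_within_Icc_at_right) simp
    then have "at 0 within R \<noteq> bot" by simp
    then show ?thesis
      using vd[OF f(1)] vd[OF f(2)] by (rule vector_derivative_unique_within)
  qed
  obtain u where u: "u \<in> U" using U by blast
  show ?thesis
  proof
    fix w
    \<comment> \<open>An arbitrary \<open>w\<close> is a multiple of the difference of two points of
      \<open>U\<close>, namely \<open>u + s w\<close> and \<open>u\<close> with \<open>s > 0\<close>
      small.\<close>
    have "((\<lambda>s. u + s *\<^sub>R w) \<longlongrightarrow> u) (at_right 0)"
      by (auto intro!: tendsto_eq_intros)
    then have "\<forall>\<^sub>F s in at_right (0::real). u + s *\<^sub>R w \<in> U \<and> s > 0"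
      using U(1) u by (intro eventually_conj topological_tendstoD eventually_at_right_less) auto
    then obtain s :: real where s: "u + s *\<^sub>R w \<in> U" "s > 0"
      using eventually_happens trivial_limit_at_right_real by blast
    from eq[OF s(1)] eq[OF u] have "s *\<^sub>R D1 w = s *\<^sub>R D2 w"
      by (simp add: D1.add D2.add D1.scaleR D2.scaleR)
    then show "D1 w = D2 w" using s(2) by simp
  qed
qed

lemma frechet_derivative_within_eq:
  assumes "has_inner_cones S" "x \<in> S" "(f has_derivative D) (at x within S)"
  shows "frechet_derivative f (at x within S) = D"
  using assms has_derivative_unique_inner_cones frechet_derivative_works
  unfolding differentiable_def by metis

lemma partial_within_linear:
  assumes S: "has_inner_cones S" "x \<in> S"
    and f: "f differentiable (at x within S)" and g: "g differentiable (at x within S)"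
  shows "partial_within S v (\<lambda>y. a *\<^sub>R f y + b *\<^sub>R g y) x
           = a *\<^sub>R partial_within S v f x + b *\<^sub>R partial_within S v g x"
proof -
  have "((\<lambda>y. a *\<^sub>R f y + b *\<^sub>R g y) has_derivative
          (\<lambda>h. a *\<^sub>R frechet_derivative f (at x within S) h
                + b *\<^sub>R frechet_derivative g (at x within S) h)) (at x within S)"
    using f g unfolding frechet_derivative_works by (intro derivative_intros)
  then show ?thesis
    unfolding partial_within_def by (simp add: frechet_derivative_within_eq[OF S])
qed

section \<open>The spaces of continuously differentiable functions\<close>

lemma Ck_on_imp_continuous_on: "Ck_on k S f \<Longrightarrow> continuous_on S f"
  by (cases k) (auto intro: differentiable_imp_continuous_on)

text \<open>Derivatives within \<open>S\<close> at points of \<open>S\<close> see only values on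
  \<open>S\<close>. This allows rewriting a partial derivative by a formula valid only at points of
  \<open>S\<close>, as in \<open>partial_within_linear\<close>.\<close>

lemma Ck_on_cong:
  assumes "\<And>x. x \<in> S \<Longrightarrow> f x = g x"
  shows "Ck_on k S f \<longleftrightarrow> Ck_on k S g"
  using assms
proof (induction k arbitrary: f g)
  case 0
  then show ?case by (simp cong: continuous_on_cong)
next
  case (Suc k)
  have der: "(f has_derivative D) (at x within S) \<longleftrightarrow> (g has_derivative D) (at x within S)"
    if "x \<in> S" for x D
    using has_derivative_transform[OF that] Suc.prems by metis
  have "f differentiable_on S \<longleftrightarrow> g differentiable_on S"
    unfolding differentiable_on_def differentiable_def using der by simp
  moreover have "Ck_on k S (partial_within S v f) \<longleftrightarrow> Ck_on k S (partial_within S v g)" for v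
    \<comment> \<open>\<open>frechet_derivative\<close> is a choice among maps satisfying
      \<open>has_derivative\<close>; by \<open>der\<close> the two predicates coincide, so the
      choices do too.\<close>
    by (rule Suc.IH) (simp add: partial_within_def frechet_derivative_def der)
  ultimately show ?case by simp
qed

text \<open>Each partial derivative of the combination is the same combination of partial
  derivatives, so the induction generalizes over \<open>f\<close> and \<open>g\<close>. It shows
  that difference quotients of the curve are of class \<open>C^k\<close>, as the bounds by
  \<open>Ck_norm\<close> require.\<close>

lemma Ck_on_linear:
  assumes S: "has_inner_cones S" and "Ck_on k S f" "Ck_on k S g"
  shows "Ck_on k S (\<lambda>x. a *\<^sub>R f x + b *\<^sub>R g x)"
  using assms(2,3)
proof (induction k arbitrary: f g)
  case 0
  then show ?case by (auto intro!: continuous_intros)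
next
  case (Suc k)
  then have df: "f differentiable_on S" "g differentiable_on S" by auto
  then have "(\<lambda>x. a *\<^sub>R f x + b *\<^sub>R g x) differentiable_on S"
    by (intro derivative_intros)
      (auto simp: differentiable_on_def)
  moreover have "Ck_on k S (partial_within S v (\<lambda>x. a *\<^sub>R f x + b *\<^sub>R g x))" if "v \<in> Basis" for v
  proof -
    have "Ck_on k S (\<lambda>x. a *\<^sub>R partial_within S v f x + b *\<^sub>R partial_within S v g x)"
      using Suc that by auto
    then show ?thesis
      using df by (subst Ck_on_cong[OF partial_within_linear[OF S]])
        (auto simp: differentiable_on_def)
  qed
  ultimately show ?case by simp
qed

text \<open>
  Only for functions of class \<open>C\<^sup>k\<close> are the summands of \<open>Ck_norm\<close> known to be nonnegative:
  the supremum of an unbounded set of reals is an unspecified number.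
\<close>

lemma norm_le_SUP_norm:
  assumes "compact S" "continuous_on S f" "x \<in> S"
  shows "norm (f x) \<le> (SUP y\<in>S. norm (f y))"
proof (rule cSUP_upper[OF assms(3)])
  have "compact ((\<lambda>y. norm (f y)) ` S)"
    using assms by (intro compact_continuous_image continuous_intros)
  then show "bdd_above ((\<lambda>y. norm (f y)) ` S)"
    by (intro bounded_imp_bdd_above compact_imp_bounded)
qed

lemma norm_le_Ck_norm:
  assumes "compact S" "Ck_on k S f" "x \<in> S"
  shows "norm (f x) \<le> Ck_norm k S f"
  using assms(2)
proof (induction k arbitrary: f)
  case 0
  then show ?case using norm_le_SUP_norm assms by auto
next
  case (Suc k)
  \<comment> \<open>The induction hypothesis at the point \<open>x\<close> bounds a norm, which also
    yields nonnegativity of the summand.\<close>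
  have "0 \<le> Ck_norm k S (partial_within S v f)" if "v \<in> Basis" for v
    using Suc.IH[of "partial_within S v f"] Suc.prems that norm_ge_zero order_trans by (metis Ck_on.simps(2))
  then have "0 \<le> (\<Sum>v\<in>Basis. Ck_norm k S (partial_within S v f))" by (rule sum_nonneg)
  moreover have "norm (f x) \<le> (SUP y\<in>S. norm (f y))"
    using norm_le_SUP_norm Ck_on_imp_continuous_on assms Suc.prems by blast
  ultimately show ?case by simp
qed

lemma norm_partial_within_le_Ck_norm:
  assumes "compact S" "Ck_on (Suc k) S f" "x \<in> S" "v \<in> Basis"
  shows "norm (partial_within S v f x) \<le> Ck_norm (Suc k) S f"
proof -
  have le: "norm (partial_within S w f x) \<le> Ck_norm k S (partial_within S w f)" if "w \<in> Basis" for w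
    using norm_le_Ck_norm[OF assms(1) _ assms(3), of k "partial_within S w f"] assms(2) that by simp
  have "norm (partial_within S v f x) \<le> Ck_norm k S (partial_within S v f)"
    using le assms by blast
  also have "\<dots> \<le> (\<Sum>w\<in>Basis. Ck_norm k S (partial_within S w f))"
    using assms(4) le by (intro member_le_sum) (auto intro: order_trans[OF norm_ge_zero])
  also have "\<dots> \<le> Ck_norm (Suc k) S f"
  proof -
    have "norm (f x) \<le> (SUP y\<in>S. norm (f y))"
      using norm_le_SUP_norm Ck_on_imp_continuous_on assms by blast
    then have "0 \<le> (SUP y\<in>S. norm (f y))" using norm_ge_zero order_trans by blast
    then show ?thesis by simp
  qed
  finally show ?thesis .
qed

section \<open>Jacobian matrices: bounds, continuity, linearity and invertibility\<close>

lemma jacobian_on_nth: "jacobian_on S f x $ i $ j = partial_within S (axis j 1) f x $ i"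
  by (simp add: jacobian_on_def jacobian_def matrix_def partial_within_def)

lemma norm_matrix_le:
  fixes M :: "real ^ 'n ^ 'm"
  assumes "\<And>i j. \<bar>M $ i $ j\<bar> \<le> B"
  shows "norm M \<le> real CARD('m) * real CARD('n) * B"
proof -
  have "norm (M $ i) \<le> real CARD('n) * B" for i
  proof -
    have "norm (M $ i) \<le> (\<Sum>j\<in>UNIV. \<bar>M $ i $ j\<bar>)" by (rule norm_le_l1_cart)
    also have "\<dots> \<le> real CARD('n) * B" using sum_bounded_above[of UNIV "\<lambda>j. \<bar>M $ i $ j\<bar>" B] assms by simp
    finally show ?thesis .
  qed
  then have "(\<Sum>i\<in>UNIV. norm (M $ i)) \<le> real CARD('m) * (real CARD('n) * B)"
    using sum_bounded_above[of UNIV "\<lambda>i. norm (M $ i)" "real CARD('n) * B"] by simp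
  moreover have "norm M \<le> (\<Sum>i\<in>UNIV. norm (M $ i))"
    unfolding norm_vec_def by (rule L2_set_le_sum) simp
  ultimately show ?thesis by simp
qed

text \<open>Each entry is a component of a partial derivative and hence at most the
  \<open>Ck_norm\<close>; the factor counts the entries.\<close>

lemma norm_jacobian_on_le_Ck_norm:
  fixes f :: "real ^ 'n \<Rightarrow> real ^ 'n"
  assumes "compact S" "Ck_on (Suc k) S f" "x \<in> S"
  shows "norm (jacobian_on S f x) \<le> (real CARD('n))\<^sup>2 * Ck_norm (Suc k) S f"
proof -
  have "\<bar>jacobian_on S f x $ i $ j\<bar> \<le> Ck_norm (Suc k) S f" for i j
    unfolding jacobian_on_nth
    using norm_partial_within_le_Ck_norm[OF assms, of "axis j 1"]
    by (intro order_trans[OF component_le_norm_cart]) simp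
  from norm_matrix_le[OF this] show ?thesis by (simp add: power2_eq_square)
qed

lemma continuous_on_jacobian_on:
  assumes "Ck_on (Suc k) S f"
  shows "continuous_on S (jacobian_on S f)"
proof -
  have "continuous_on S (\<lambda>x. jacobian_on S f x $ i $ j)" for i j
    unfolding jacobian_on_nth
    by (intro continuous_intros Ck_on_imp_continuous_on[of k])
      (use assms in auto)
  then have "continuous_on S (\<lambda>x. \<chi> i. \<chi> j. jacobian_on S f x $ i $ j)"
    by (intro continuous_on_vec_lambda)
  then show ?thesis by simp
qed

lemma jacobian_on_linear:
  fixes f g :: "real ^ 'n \<Rightarrow> real ^ 'n"
  assumes "has_inner_cones S" "x \<in> S" "f differentiable_on S" "g differentiable_on S"
  shows "jacobian_on S (\<lambda>y. a *\<^sub>R f y + b *\<^sub>R g y) x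
           = a *\<^sub>R jacobian_on S f x + b *\<^sub>R jacobian_on S g x"
  using assms unfolding vec_eq_iff
  by (simp add: jacobian_on_nth partial_within_linear differentiable_on_def)

text \<open>The chain rule is applied to the inverse map after \<open>T\<close>, which is the
  identity on \<open>S\<close>. Uniqueness of derivatives within \<open>S\<close> identifies
  \<open>E \<circ> D\<close> with the identity, and a left inverse suffices for a square matrix.
  \<open>E\<close> may be any derivative of the inverse map within the image.\<close>

lemma invertible_jacobian_on:
  fixes T :: "real ^ 'n \<Rightarrow> real ^ 'n"
  assumes S: "has_inner_cones S" and T: "Ck_diffeo_onto_image (Suc k) S T" and x: "x \<in> S"
  shows "invertible (jacobian_on S T x)"
proof -
  let ?G = "inv_into S T"
  obtain D E where D: "(T has_derivative D) (at x within S)"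
    and E: "(?G has_derivative E) (at (T x) within T ` S)"
    using T x unfolding Ck_diffeo_onto_image_def Ck_on.simps differentiable_on_def differentiable_def
    by blast
  have "(?G \<circ> T has_derivative E \<circ> D) (at x within S)"
    using D E by (rule diff_chain_within)
  moreover have "?G (T y) = y" if "y \<in> S" for y
    using T that by (simp add: Ck_diffeo_onto_image_def)
  ultimately have "((\<lambda>y. y) has_derivative E \<circ> D) (at x within S)"
    using has_derivative_transform[OF x, of "\<lambda>y. y" "?G \<circ> T"] by simp
  then have "E \<circ> D = (\<lambda>y. y)"
    using has_derivative_unique_inner_cones[OF S x] has_derivative_ident by blast
  moreover have "linear D" "linear E" using D E has_derivative_linear by auto
  ultimately have "matrix E ** matrix D = mat 1"
    using matrix_compose[of D E] by (simp flip: id_def add: matrix_id_mat_1)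
  moreover have "jacobian_on S T x = matrix D"
    by (simp add: jacobian_on_def jacobian_def frechet_derivative_within_eq[OF S x D])
  ultimately show ?thesis by (metis invertible_left_inverse)
qed

section \<open>Inverse matrices\<close>

lemma matrix_inv_mult:
  fixes A :: "real ^ 'n ^ 'n"
  assumes "invertible A"
  shows "A ** matrix_inv A = mat 1" "matrix_inv A ** A = mat 1"
  using someI_ex[OF assms[unfolded invertible_def]] unfolding matrix_inv_def by auto

lemma matrix_inv_unique:
  fixes A :: "real ^ 'n ^ 'n"
  assumes "B ** A = mat 1"
  shows "matrix_inv A = B"
proof -
  have "invertible A" using assms invertible_left_inverse by blast
  then have "B ** (A ** matrix_inv A) = B" by (simp add: matrix_inv_mult)
  then show ?thesis by (simp add: matrix_mul_assoc assms)
qed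

text \<open>Expressing the inverse Gram matrix through \<open>matrix_inv A\<close> reduces the
  analysis of \<open>dyn_matrix\<close> to that of the inverse Jacobian.\<close>

lemma matrix_inv_gram:
  fixes A :: "real ^ 'n ^ 'n"
  assumes "invertible A"
  shows "matrix_inv (transpose A ** A) = matrix_inv A ** transpose (matrix_inv A)"
proof (rule matrix_inv_unique)
  have "transpose (matrix_inv A) ** transpose A = mat 1"
    using assms by (metis matrix_inv_mult(1) matrix_transpose_mul transpose_mat)
  then have "matrix_inv A ** (transpose (matrix_inv A) ** transpose A) ** A = mat 1"
    using assms by (simp add: matrix_inv_mult)
  then show "matrix_inv A ** transpose (matrix_inv A) ** (transpose A ** A) = mat 1"
    by (simp add: matrix_mul_assoc)
qed

text \<open>Bilinear maps between finite-dimensional spaces are bounded. This supplies a norm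
  estimate up to a constant and the rules for differences, continuity and uniform limits of
  products.\<close>

lemma bounded_bilinear_matrix_mult:
  "bounded_bilinear (\<lambda>(A :: real ^ 'n ^ 'm) (B :: real ^ 'k ^ 'n). A ** B)"
proof -
  have "linear (\<lambda>A :: real ^ 'n ^ 'm. A ** B)" for B :: "real ^ 'k ^ 'n"
    by (intro linearI)
      (simp_all add: vec_eq_iff matrix_matrix_mult_def distrib_right sum.distrib sum_distrib_left mult.assoc)
  then show ?thesis
    unfolding bilinear_conv_bounded_bilinear[symmetric] bilinear_def
    by (auto intro!: linearI simp: matrix_add_ldistrib matrix_scalar_ac scalar_matrix_assoc)
qed

lemma matrix_inv_diff:
  fixes A B :: "real ^ 'n ^ 'n"
  assumes "invertible A" "invertible B"
  shows "matrix_inv A - matrix_inv B = - (matrix_inv A ** (A - B) ** matrix_inv B)"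
proof -
  have "matrix_inv A ** (A - B) ** matrix_inv B
      = matrix_inv A ** A ** matrix_inv B - matrix_inv A ** (B ** matrix_inv B)"
    by (simp add: bounded_bilinear.diff_left[OF bounded_bilinear_matrix_mult]
        bounded_bilinear.diff_right[OF bounded_bilinear_matrix_mult] matrix_mul_assoc)
  then show ?thesis using assms by (simp add: matrix_inv_mult)
qed

lemma bounded_bilinear_matrix_vector_mult:
  "bounded_bilinear (\<lambda>(A :: real ^ 'n ^ 'm) x. A *v x)"
  unfolding bilinear_conv_bounded_bilinear[symmetric] bilinear_def
  by (auto intro!: linearI simp: matrix_vector_right_distrib matrix_vector_mult_add_rdistrib
      matrix_vector_mult_scaleR scaleR_matrix_vector_assoc)

lemma bounded_linear_transpose: "bounded_linear (transpose :: real ^ 'n ^ 'm \<Rightarrow> real ^ 'm ^ 'n)"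
  by (intro linear_conv_bounded_linear[THEN iffD1] linearI)
    (simp_all add: transpose_def vec_eq_iff)

lemma continuous_on_matrix_mult:
  fixes f :: "'a::topological_space \<Rightarrow> real ^ 'n ^ 'm" and g :: "'a \<Rightarrow> real ^ 'k ^ 'n"
  shows "continuous_on S f \<Longrightarrow> continuous_on S g \<Longrightarrow> continuous_on S (\<lambda>x. f x ** g x)"
  by (rule bounded_bilinear.continuous_on[OF bounded_bilinear_matrix_mult])

lemma continuous_on_transpose:
  fixes f :: "'a::topological_space \<Rightarrow> real ^ 'n ^ 'm"
  shows "continuous_on S f \<Longrightarrow> continuous_on S (\<lambda>x. transpose (f x))"
  by (rule bounded_linear.continuous_on[OF bounded_linear_transpose])

text \<open>The identity \<open>matrix_inv_diff\<close> bounds the error by the norm of the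
  perturbed inverse times a small factor. Absorbing this first gives an a priori bound on the
  perturbed inverse; inserting that bound then makes the error small.\<close>

lemma uniform_limit_matrix_inv:
  fixes D :: "'c \<Rightarrow> 'b \<Rightarrow> real ^ 'n ^ 'n"
  assumes lim: "uniform_limit S D D0 F"
    and inv: "\<forall>\<^sub>F e in F. \<forall>x\<in>S. invertible (D e x)" "\<And>x. x \<in> S \<Longrightarrow> invertible (D0 x)"
    and bdd: "bounded ((\<lambda>x. matrix_inv (D0 x)) ` S)"
  shows "uniform_limit S (\<lambda>e x. matrix_inv (D e x)) (\<lambda>x. matrix_inv (D0 x)) F"
proof (rule uniform_limitI)
  fix r :: real assume r: "r > 0"
  obtain M where M: "M > 0" "\<And>x. x \<in> S \<Longrightarrow> norm (matrix_inv (D0 x)) \<le> M"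
    using bdd by (auto simp: bounded_pos)
  obtain K where K: "K > 0" "\<And>(A :: real ^ 'n ^ 'n) (B :: real ^ 'n ^ 'n). norm (A ** B) \<le> norm A * norm B * K"
    using bounded_bilinear.pos_bounded[OF bounded_bilinear_matrix_mult] by auto
  \<comment> \<open>The first entry makes the factor \<open>d * K\<^sup>2 * M\<close> at most
    \<open>1/2\<close>, for the absorption; the second makes the final bound at most
    \<open>r / 2\<close>. The square of \<open>K\<close> comes from the two matrix products.\<close>
  define d where "d = min (1 / (2 * K\<^sup>2 * M)) (r / (4 * K\<^sup>2 * M\<^sup>2))"
  have d: "d > 0" using K M r by (simp add: d_def)
  have d1: "d * (K\<^sup>2 * M) \<le> 1 / 2"
  proof -
    have "d * (K\<^sup>2 * M) \<le> 1 / (2 * K\<^sup>2 * M) * (K\<^sup>2 * M)"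
      using K M by (intro mult_right_mono) (auto simp: d_def)
    then show ?thesis using K M by simp
  qed
  have d2: "2 * M * d * (K\<^sup>2 * M) < r"
  proof -
    have "2 * M * d * (K\<^sup>2 * M) \<le> 2 * M * (r / (4 * K\<^sup>2 * M\<^sup>2)) * (K\<^sup>2 * M)"
      using K M by (intro mult_right_mono mult_left_mono) (auto simp: d_def)
    also have "\<dots> = r / 2" using K M by (simp add: field_simps power2_eq_square)
    finally show ?thesis using r by simp
  qed
  from uniform_limitD[OF lim d] inv(1)
  show "\<forall>\<^sub>F e in F. \<forall>x\<in>S. dist (matrix_inv (D e x)) (matrix_inv (D0 x)) < r"
  proof eventually_elim
    case (elim e)
    show ?case
    proof
      fix x assume x: "x \<in> S"
      define E where "E = matrix_inv (D e x)"
      define E0 where "E0 = matrix_inv (D0 x)"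
      have *: "norm (D e x - D0 x) \<le> d" using elim x by (force simp: dist_norm)
      have "norm (E - E0) = norm (E ** (D e x - D0 x) ** E0)"
        unfolding E_def E0_def using elim x inv by (simp add: matrix_inv_diff)
      also have "\<dots> \<le> norm (E ** (D e x - D0 x)) * norm E0 * K" by (rule K(2))
      also have "\<dots> \<le> (norm E * d * K) * M * K"
      proof (intro mult_right_mono mult_mono)
        show "norm (E ** (D e x - D0 x)) \<le> norm E * d * K"
          by (rule order_trans[OF K(2)]) (use K * in \<open>intro mult_right_mono mult_left_mono; simp\<close>)
        show "norm E0 \<le> M" unfolding E0_def by (rule M(2)[OF x])
      qed (use K d in auto)
      finally have le: "norm (E - E0) \<le> norm E * (d * (K\<^sup>2 * M))"
        by (simp add: power2_eq_square mult_ac)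
      also have "\<dots> \<le> norm E * (1 / 2)" using d1 by (intro mult_left_mono) auto
      \<comment> \<open>Absorption: half of \<open>norm E\<close> is moved to the left, which leaves
        \<open>norm E \<le> 2 * norm E0\<close>.\<close>
      finally have "norm E - norm E0 \<le> norm E * (1 / 2)"
        using norm_triangle_ineq2 order_trans by blast
      then have "norm E \<le> 2 * M" using M(2)[OF x] by (simp add: E0_def)
      then have "norm E * (d * (K\<^sup>2 * M)) \<le> 2 * M * (d * (K\<^sup>2 * M))"
        using d K M by (intro mult_right_mono) auto
      then show "dist (matrix_inv (D e x)) (matrix_inv (D0 x)) < r"
        using le d2 by (simp add: dist_norm E_def E0_def mult_ac)
    qed
  qed
qed

text \<open>Continuity at \<open>x\<close> is uniform convergence over the one-point set
  \<open>{x}\<close>, with the nearby point \<open>y\<close> playing the role of the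
  parameter.\<close>

lemma continuous_on_matrix_inv:
  fixes D :: "'b::topological_space \<Rightarrow> real ^ 'n ^ 'n"
  assumes "continuous_on S D" "\<And>x. x \<in> S \<Longrightarrow> invertible (D x)"
  shows "continuous_on S (\<lambda>x. matrix_inv (D x))"
  unfolding continuous_on_def
proof
  fix x assume x: "x \<in> S"
  have "uniform_limit {x} (\<lambda>y _. matrix_inv (D y)) (\<lambda>_. matrix_inv (D x)) (at x within S)"
  proof (rule uniform_limit_matrix_inv)
    show "uniform_limit {x} (\<lambda>y _. D y) (\<lambda>_. D x) (at x within S)"
      using assms x by (simp add: continuous_on_def)
    show "\<forall>\<^sub>F y in at x within S. \<forall>z\<in>{x}. invertible (D y)"
      using assms by (simp add: eventually_at_topological) blast
  qed (use assms x in auto)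
  then show "((\<lambda>y. matrix_inv (D y)) \<longlongrightarrow> matrix_inv (D x)) (at x within S)" by simp
qed

section \<open>Convergence of the bilinear forms\<close>

lemma weak_gradient_in_L2:
  assumes "u \<in> H1 \<Omega>"
  shows "weak_gradient \<Omega> u \<in> L2 \<Omega>"
proof -
  have "\<exists>G. G \<in> L2 \<Omega> \<and> is_weak_gradient \<Omega> u G" using assms by (auto simp: H1_def)
  from someI_ex[OF this] show ?thesis by (simp add: weak_gradient_def)
qed

text \<open>Bounding the product of norms by the sum of squares gives a majorant that is integrable
  directly by the definition of \<open>L2\<close>.\<close>

lemma norm_matrix_vector_inner_le:
  obtains K where "K > 0"
    "\<And>(M :: real ^ 'n ^ 'm) a b. \<bar>(M *v a) \<bullet> b\<bar> \<le> norm M * (K * ((norm a)\<^sup>2 + (norm b)\<^sup>2))"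
proof -
  obtain K where K: "K > 0" "\<And>(M :: real ^ 'n ^ 'm) a. norm (M *v a) \<le> norm M * norm a * K"
    using bounded_bilinear.pos_bounded[OF bounded_bilinear_matrix_vector_mult] by auto
  have "\<bar>(M *v a) \<bullet> b\<bar> \<le> norm M * (K * ((norm a)\<^sup>2 + (norm b)\<^sup>2))"
    for M :: "real ^ 'n ^ 'm" and a b
  proof -
    have "0 \<le> (norm a - norm b)\<^sup>2" "0 \<le> (norm a)\<^sup>2" "0 \<le> (norm b)\<^sup>2" by simp_all
    then have ab: "norm a * norm b \<le> (norm a)\<^sup>2 + (norm b)\<^sup>2"
      unfolding power2_diff by linarith
    have "\<bar>(M *v a) \<bullet> b\<bar> \<le> norm (M *v a) * norm b" by (rule Cauchy_Schwarz_ineq2)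
    also have "\<dots> \<le> norm M * norm a * K * norm b" by (intro mult_right_mono K(2)) simp
    also have "\<dots> = norm M * (K * (norm a * norm b))" by simp
    also have "\<dots> \<le> norm M * (K * ((norm a)\<^sup>2 + (norm b)\<^sup>2))"
      using ab K(1) by (intro mult_left_mono) auto
    finally show ?thesis .
  qed
  with K(1) show ?thesis by (rule that)
qed

text \<open>A continuous coefficient is bounded on the compact set, so a multiple of the sum of the
  squared norms of \<open>G1\<close> and \<open>G2\<close> dominates the integrand.\<close>

lemma integrable_matrix_form:
  fixes F :: "real ^ 'n \<Rightarrow> real ^ 'n ^ 'n"
  assumes \<Omega>: "compact \<Omega>" and F: "continuous_on \<Omega> F"
    and G: "G1 \<in> L2 \<Omega>" "G2 \<in> L2 \<Omega>"
  shows "integrable (lebesgue_on \<Omega>) (\<lambda>x. (F x *v G1 x) \<bullet> G2 x)"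
proof -
  have meas\<Omega>: "\<Omega> \<in> sets lebesgue" using \<Omega> lmeasurable_compact by blast
  have mG [measurable]: "G1 \<in> borel_measurable (lebesgue_on \<Omega>)" "G2 \<in> borel_measurable (lebesgue_on \<Omega>)"
    and iG: "integrable (lebesgue_on \<Omega>) (\<lambda>x. (norm (G1 x))\<^sup>2)"
      "integrable (lebesgue_on \<Omega>) (\<lambda>x. (norm (G2 x))\<^sup>2)"
    using G by (auto simp: L2_def)
  have mF: "F \<in> borel_measurable (lebesgue_on \<Omega>)"
    using F meas\<Omega> by (rule continuous_imp_measurable_on_sets_lebesgue)
  \<comment> \<open>Measurability follows by composing the pair of measurable maps with the
    continuous bilinear action.\<close>
  have [measurable]: "(\<lambda>x. F x *v G1 x) \<in> borel_measurable (lebesgue_on \<Omega>)"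
  proof (rule borel_measurable_continuous_Pair[OF mF mG(1)])
    show "continuous_on UNIV (\<lambda>x :: (real ^ 'n ^ 'n) \<times> (real ^ 'n). fst x *v snd x)"
      by (intro bounded_bilinear.continuous_on[OF bounded_bilinear_matrix_vector_mult] continuous_intros)
  qed
  have "bounded (F ` \<Omega>)" using compact_continuous_image[OF F \<Omega>] by (rule compact_imp_bounded)
  then obtain B where B: "\<And>x. x \<in> \<Omega> \<Longrightarrow> norm (F x) \<le> B" by (auto simp: bounded_iff)
  obtain K where K: "K > 0"
    "\<And>(M :: real ^ 'n ^ 'n) a b. \<bar>(M *v a) \<bullet> b\<bar> \<le> norm M * (K * ((norm a)\<^sup>2 + (norm b)\<^sup>2))"
    using norm_matrix_vector_inner_le by metis
  show ?thesis
  proof (rule Bochner_Integration.integrable_bound)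
    show "integrable (lebesgue_on \<Omega>) (\<lambda>x. B * (K * ((norm (G1 x))\<^sup>2 + (norm (G2 x))\<^sup>2)))"
      using iG by (intro integrable_mult_right Bochner_Integration.integrable_add)
    show "(\<lambda>x. (F x *v G1 x) \<bullet> G2 x) \<in> borel_measurable (lebesgue_on \<Omega>)" by measurable
    show "AE x in lebesgue_on \<Omega>. norm ((F x *v G1 x) \<bullet> G2 x)
            \<le> norm (B * (K * ((norm (G1 x))\<^sup>2 + (norm (G2 x))\<^sup>2)))"
    proof (rule AE_I2)
      fix x assume "x \<in> space (lebesgue_on \<Omega>)"
      then have x: "x \<in> \<Omega>" by simp
      have "\<bar>(F x *v G1 x) \<bullet> G2 x\<bar> \<le> norm (F x) * (K * ((norm (G1 x))\<^sup>2 + (norm (G2 x))\<^sup>2))"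
        by (rule K(2))
      also have "\<dots> \<le> B * (K * ((norm (G1 x))\<^sup>2 + (norm (G2 x))\<^sup>2))"
        using B[OF x] K(1) by (intro mult_right_mono) auto
      finally show "norm ((F x *v G1 x) \<bullet> G2 x) \<le> norm (B * (K * ((norm (G1 x))\<^sup>2 + (norm (G2 x))\<^sup>2)))"
        by simp
    qed
  qed
qed

text \<open>The difference of the two forms is at most the uniform distance of the coefficients
  times the integral \<open>C\<close> of a fixed integrable majorant.\<close>

lemma tendsto_gradient_form:
  fixes F :: "'c \<Rightarrow> real ^ 'n \<Rightarrow> real ^ 'n ^ 'n"
  assumes \<Omega>: "compact \<Omega>" and lim: "uniform_limit \<Omega> F F0 net"
    and F: "\<forall>\<^sub>F e in net. continuous_on \<Omega> (F e)" and F0: "continuous_on \<Omega> F0"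
    and u: "\<psi> \<in> H1 \<Omega>" "\<phi> \<in> H1 \<Omega>"
  shows "((\<lambda>e. gradient_form \<Omega> (F e) \<psi> \<phi>) \<longlongrightarrow> gradient_form \<Omega> F0 \<psi> \<phi>) net"
proof -
  define G1 where "G1 = weak_gradient \<Omega> \<psi>"
  define G2 where "G2 = weak_gradient \<Omega> \<phi>"
  have G: "G1 \<in> L2 \<Omega>" "G2 \<in> L2 \<Omega>" using u by (simp_all add: G1_def G2_def weak_gradient_in_L2)
  obtain K where K: "K > 0"
    "\<And>(M :: real ^ 'n ^ 'n) a b. \<bar>(M *v a) \<bullet> b\<bar> \<le> norm M * (K * ((norm a)\<^sup>2 + (norm b)\<^sup>2))"
    using norm_matrix_vector_inner_le by metis
  define h where "h x = K * ((norm (G1 x))\<^sup>2 + (norm (G2 x))\<^sup>2)" for x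
  have h: "integrable (lebesgue_on \<Omega>) h"
    unfolding h_def using G by (auto simp: L2_def)
  have h0: "0 \<le> h x" for x using K(1) by (simp add: h_def)
  define C where "C = (LINT x|lebesgue_on \<Omega>. h x)"
  have C: "0 \<le> C" unfolding C_def by (intro integral_nonneg_AE) (simp add: h0)
  show ?thesis
  proof (rule tendstoI)
    fix r :: real assume r: "r > 0"
    \<comment> \<open>Adding \<open>1\<close> keeps the denominator positive when
      \<open>C = 0\<close> and makes \<open>d * C < r\<close> strict.\<close>
    define d where "d = r / (C + 1)"
    have d: "d > 0" using r C by (simp add: d_def)
    have dC: "d * C < r" using r C by (simp add: d_def field_simps)
    from uniform_limitD[OF lim d] F
    show "\<forall>\<^sub>F e in net. dist (gradient_form \<Omega> (F e) \<psi> \<phi>) (gradient_form \<Omega> F0 \<psi> \<phi>) < r"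
    proof eventually_elim
      case (elim e)
      have i: "integrable (lebesgue_on \<Omega>) (\<lambda>x. (F e x *v G1 x) \<bullet> G2 x)"
        "integrable (lebesgue_on \<Omega>) (\<lambda>x. (F0 x *v G1 x) \<bullet> G2 x)"
        using elim F0 G \<Omega> by (auto intro: integrable_matrix_form)
      have "gradient_form \<Omega> (F e) \<psi> \<phi> - gradient_form \<Omega> F0 \<psi> \<phi>
          = (LINT x|lebesgue_on \<Omega>. (F e x *v G1 x) \<bullet> G2 x - (F0 x *v G1 x) \<bullet> G2 x)"
        using i by (simp add: gradient_form_def G1_def G2_def)
      also have "\<bar>\<dots>\<bar> \<le> (LINT x|lebesgue_on \<Omega>. \<bar>(F e x *v G1 x) \<bullet> G2 x - (F0 x *v G1 x) \<bullet> G2 x\<bar>)"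
        by (rule integral_abs_bound)
      also have "\<dots> \<le> (LINT x|lebesgue_on \<Omega>. d * h x)"
      proof (rule integral_mono)
        show "integrable (lebesgue_on \<Omega>) (\<lambda>x. \<bar>(F e x *v G1 x) \<bullet> G2 x - (F0 x *v G1 x) \<bullet> G2 x\<bar>)"
          using i by (intro integrable_abs Bochner_Integration.integrable_diff)
        show "integrable (lebesgue_on \<Omega>) (\<lambda>x. d * h x)" using h by simp
        fix x assume "x \<in> space (lebesgue_on \<Omega>)"
        then have "norm (F e x - F0 x) \<le> d" using elim by (force simp: dist_norm)
        then have "norm (F e x - F0 x) * h x \<le> d * h x" using h0 by (rule mult_right_mono)
        moreover have "\<bar>((F e x - F0 x) *v G1 x) \<bullet> G2 x\<bar> \<le> norm (F e x - F0 x) * h x"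
          unfolding h_def by (rule K(2))
        ultimately show "\<bar>(F e x *v G1 x) \<bullet> G2 x - (F0 x *v G1 x) \<bullet> G2 x\<bar> \<le> d * h x"
          by (simp add: matrix_vector_mult_diff_rdistrib inner_diff_left)
      qed
      also have "\<dots> = d * C" by (simp add: C_def)
      finally show ?case using dC by (simp add: dist_real_def)
    qed
  qed
qed

text \<open>The form is linear in its coefficient matrix once both integrands are integrable. For
  \<open>c = 0\<close> both sides are \<open>0\<close> by the conventions for division by
  zero.\<close>

lemma gradient_form_diff_quotient:
  fixes A B :: "real ^ 'n \<Rightarrow> real ^ 'n ^ 'n"
  assumes "compact \<Omega>" "continuous_on \<Omega> A" "continuous_on \<Omega> B" "\<psi> \<in> H1 \<Omega>" "\<phi> \<in> H1 \<Omega>"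
  shows "(gradient_form \<Omega> A \<psi> \<phi> - gradient_form \<Omega> B \<psi> \<phi>) / c
           = gradient_form \<Omega> (\<lambda>x. (A x - B x) /\<^sub>R c) \<psi> \<phi>"
proof -
  let ?G = "weak_gradient \<Omega>"
  have i: "integrable (lebesgue_on \<Omega>) (\<lambda>x. (A x *v ?G \<psi> x) \<bullet> ?G \<phi> x)"
    "integrable (lebesgue_on \<Omega>) (\<lambda>x. (B x *v ?G \<psi> x) \<bullet> ?G \<phi> x)"
    using assms by (auto intro: integrable_matrix_form weak_gradient_in_L2)
  have "(((A x - B x) /\<^sub>R c) *v ?G \<psi> x) \<bullet> ?G \<phi> x
      = ((A x *v ?G \<psi> x) \<bullet> ?G \<phi> x - (B x *v ?G \<psi> x) \<bullet> ?G \<phi> x) / c" for x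
    by (simp add: scaleR_matrix_vector_assoc[symmetric] matrix_vector_mult_diff_rdistrib
        inner_diff_left divide_inverse mult.commute)
  then show ?thesis using i by (simp add: gradient_form_def)
qed

section \<open>Difference quotients of Jacobians and of coefficient matrices\<close>

text \<open>By linearity the error is the Jacobian of \<open>h \<delta>\<close>, the error of the
  difference quotient of the curve, and its norm is controlled by the \<open>Ck_norm\<close> that
  tends to \<open>0\<close>.\<close>

lemma C1_curve_uniform_limit_jacobian:
  fixes T T' :: "real \<Rightarrow> real ^ 'n \<Rightarrow> real ^ 'n"
  assumes \<Omega>: "compact \<Omega>" "has_inner_cones \<Omega>"
    and T: "C1_curve_in_Ck (Suc k) \<Omega> I T T'" and I: "open I" "\<epsilon> \<in> I"
  shows "uniform_limit \<Omega> (\<lambda>\<delta> x. (jacobian_on \<Omega> (T \<delta>) x - jacobian_on \<Omega> (T \<epsilon>) x) /\<^sub>R (\<delta> - \<epsilon>))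
           (jacobian_on \<Omega> (T' \<epsilon>)) (at \<epsilon>)"
proof (rule uniform_limitI)
  fix r :: real assume r: "r > 0"
  define h where "h \<delta> x = (T \<delta> x - T \<epsilon> x) /\<^sub>R (\<delta> - \<epsilon>) - T' \<epsilon> x" for \<delta> x
  define c where "c = (real CARD('n))\<^sup>2"
  have Ck: "Ck_on (Suc k) \<Omega> (T \<delta>)" "Ck_on (Suc k) \<Omega> (T' \<delta>)" if "\<delta> \<in> I" for \<delta>
    using T that by (auto simp: C1_curve_in_Ck_def)
  have "((\<lambda>\<delta>. Ck_norm (Suc k) \<Omega> (h \<delta>)) \<longlongrightarrow> 0) (at \<epsilon>)"
    using T I unfolding C1_curve_in_Ck_def h_def by blast
  then have "((\<lambda>\<delta>. c * Ck_norm (Suc k) \<Omega> (h \<delta>)) \<longlongrightarrow> 0) (at \<epsilon>)"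
    by (rule tendsto_mult_right_zero)
  then have "\<forall>\<^sub>F \<delta> in at \<epsilon>. c * Ck_norm (Suc k) \<Omega> (h \<delta>) < r"
    using r by (rule order_tendstoD)
  moreover have "\<forall>\<^sub>F \<delta> in at \<epsilon>. \<delta> \<in> I" using I by (rule eventually_at_in_open')
  ultimately show "\<forall>\<^sub>F \<delta> in at \<epsilon>. \<forall>x\<in>\<Omega>.
      dist ((jacobian_on \<Omega> (T \<delta>) x - jacobian_on \<Omega> (T \<epsilon>) x) /\<^sub>R (\<delta> - \<epsilon>)) (jacobian_on \<Omega> (T' \<epsilon>) x) < r"
  proof eventually_elim
    case (elim \<delta>)
    \<comment> \<open>The quotient is written as a linear combination to fit
      \<open>Ck_on_linear\<close> and \<open>jacobian_on_linear\<close>; then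
      \<open>h \<delta>\<close> is \<open>q\<close> minus \<open>T' \<epsilon>\<close>.\<close>
    define q where "q x = inverse (\<delta> - \<epsilon>) *\<^sub>R T \<delta> x + (- inverse (\<delta> - \<epsilon>)) *\<^sub>R T \<epsilon> x" for x
    have h_eq: "h \<delta> = (\<lambda>x. 1 *\<^sub>R q x + (- 1) *\<^sub>R T' \<epsilon> x)"
      by (simp add: h_def q_def fun_eq_iff scaleR_diff_right)
    have q: "Ck_on (Suc k) \<Omega> q"
      unfolding q_def using \<Omega> Ck I elim by (intro Ck_on_linear)
    then have h: "Ck_on (Suc k) \<Omega> (h \<delta>)"
      unfolding h_eq using \<Omega> Ck I by (intro Ck_on_linear)
    show ?case
    proof
      fix x assume x: "x \<in> \<Omega>"
      have "jacobian_on \<Omega> (h \<delta>) x = 1 *\<^sub>R jacobian_on \<Omega> q x + (- 1) *\<^sub>R jacobian_on \<Omega> (T' \<epsilon>) x"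
        unfolding h_eq using \<Omega>(2) x q Ck(2)[OF I(2)] by (intro jacobian_on_linear) auto
      also have "jacobian_on \<Omega> q x = inverse (\<delta> - \<epsilon>) *\<^sub>R jacobian_on \<Omega> (T \<delta>) x
          + (- inverse (\<delta> - \<epsilon>)) *\<^sub>R jacobian_on \<Omega> (T \<epsilon>) x"
        unfolding q_def using \<Omega>(2) x Ck(1)[OF I(2)] Ck(1)[OF elim(2)]
        by (intro jacobian_on_linear) auto
      finally have "dist ((jacobian_on \<Omega> (T \<delta>) x - jacobian_on \<Omega> (T \<epsilon>) x) /\<^sub>R (\<delta> - \<epsilon>))
          (jacobian_on \<Omega> (T' \<epsilon>) x) = norm (jacobian_on \<Omega> (h \<delta>) x)"
        by (simp add: dist_norm scaleR_diff_right)
      also have "\<dots> \<le> c * Ck_norm (Suc k) \<Omega> (h \<delta>)"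
        unfolding c_def using \<Omega>(1) h x by (rule norm_jacobian_on_le_Ck_norm)
      also have "\<dots> < r" by (rule elim)
      finally show "dist ((jacobian_on \<Omega> (T \<delta>) x - jacobian_on \<Omega> (T \<epsilon>) x) /\<^sub>R (\<delta> - \<epsilon>))
          (jacobian_on \<Omega> (T' \<epsilon>) x) < r" .
    qed
  qed
qed

lemma dyn_matrix_eq:
  assumes "invertible (jacobian_on \<Omega> T x)"
  shows "dyn_matrix \<Omega> T x = (1 / 2) *\<^sub>R (mat 1 +
    matrix_inv (jacobian_on \<Omega> T x) ** transpose (matrix_inv (jacobian_on \<Omega> T x)))"
  using assms by (simp add: dyn_matrix_def matrix_inv_gram)

lemma continuous_on_dyn_matrix:
  assumes "has_inner_cones \<Omega>" "Ck_diffeo_onto_image (Suc k) \<Omega> T"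
  shows "continuous_on \<Omega> (dyn_matrix \<Omega> T)"
proof -
  have inv: "invertible (jacobian_on \<Omega> T x)" if "x \<in> \<Omega>" for x
    using assms that by (rule invertible_jacobian_on)
  have "Ck_on (Suc k) \<Omega> T" using assms by (simp add: Ck_diffeo_onto_image_def)
  then have "continuous_on \<Omega> (\<lambda>x. matrix_inv (jacobian_on \<Omega> T x))"
    by (intro continuous_on_matrix_inv continuous_on_jacobian_on inv)
  then have "continuous_on \<Omega> (\<lambda>x. (1 / 2) *\<^sub>R (mat 1 +
      matrix_inv (jacobian_on \<Omega> T x) ** transpose (matrix_inv (jacobian_on \<Omega> T x))))"
    by (intro continuous_intros continuous_on_matrix_mult continuous_on_transpose)
  then show ?thesis by (simp add: dyn_matrix_eq inv cong: continuous_on_cong)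
qed

lemma continuous_on_dyn_matrix_deriv:
  assumes "has_inner_cones \<Omega>" "Ck_diffeo_onto_image (Suc k) \<Omega> T" "Ck_on (Suc k) \<Omega> T'"
  shows "continuous_on \<Omega> (dyn_matrix_deriv \<Omega> T T')"
proof -
  have "Ck_on (Suc k) \<Omega> T" using assms by (simp add: Ck_diffeo_onto_image_def)
  then have "continuous_on \<Omega> (\<lambda>x. matrix_inv (jacobian_on \<Omega> T x))"
    by (intro continuous_on_matrix_inv continuous_on_jacobian_on invertible_jacobian_on[OF assms(1,2)])
  then show ?thesis
    unfolding dyn_matrix_deriv_def[abs_def] sym_part_def using assms(3)
    by (intro continuous_intros continuous_on_matrix_mult continuous_on_transpose continuous_on_jacobian_on)
qed

text \<open>With \<open>E\<close> the inverse Jacobian, the coefficient matrix is half of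
  \<open>mat 1\<close> plus \<open>E\<close> times its transpose. The product rule turns the limit
  \<open>R'\<close> of the difference quotients of \<open>E\<close> into the limit for the
  matrices.\<close>

lemma uniform_limit_dyn_matrix_diff_quotient:
  fixes T T' :: "real \<Rightarrow> real ^ 'n \<Rightarrow> real ^ 'n"
  assumes \<Omega>: "compact \<Omega>" "has_inner_cones \<Omega>"
    and diffeo: "\<And>\<epsilon>. \<epsilon> \<in> I \<Longrightarrow> Ck_diffeo_onto_image (Suc k) \<Omega> (T \<epsilon>)"
    and T: "C1_curve_in_Ck (Suc k) \<Omega> I T T'" and I: "open I" "\<epsilon> \<in> I"
  shows "uniform_limit \<Omega> (\<lambda>\<delta> x. (dyn_matrix \<Omega> (T \<delta>) x - dyn_matrix \<Omega> (T \<epsilon>) x) /\<^sub>R (\<delta> - \<epsilon>))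
           (dyn_matrix_deriv \<Omega> (T \<epsilon>) (T' \<epsilon>)) (at \<epsilon>)"
proof -
  define D where "D \<delta> = jacobian_on \<Omega> (T \<delta>)" for \<delta>
  define D' where "D' = jacobian_on \<Omega> (T' \<epsilon>)"
  define E where "E \<delta> x = matrix_inv (D \<delta> x)" for \<delta> x
  define Q where "Q \<delta> x = (D \<delta> x - D \<epsilon> x) /\<^sub>R (\<delta> - \<epsilon>)" for \<delta> x
  \<comment> \<open>This is the difference quotient of \<open>E\<close> as rewritten by
    \<open>matrix_inv_diff\<close>, a product of factors whose limits are known.\<close>
  define R where "R \<delta> x = - (E \<delta> x ** Q \<delta> x ** E \<epsilon> x)" for \<delta> x
  define R' where "R' x = - (E \<epsilon> x ** D' x ** E \<epsilon> x)" for x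
  have inv: "invertible (D \<delta> x)" if "\<delta> \<in> I" "x \<in> \<Omega>" for \<delta> x
    unfolding D_def using \<Omega>(2) diffeo[OF that(1)] that(2) by (rule invertible_jacobian_on)
  have evI: "\<forall>\<^sub>F \<delta> in at \<epsilon>. \<delta> \<in> I" using I by (rule eventually_at_in_open')
  have ne: "\<forall>\<^sub>F \<delta> in at \<epsilon>. \<delta> \<noteq> \<epsilon>" by (rule eventually_neq_at_within)
  have "Ck_on (Suc k) \<Omega> (T \<epsilon>)" "Ck_on (Suc k) \<Omega> (T' \<epsilon>)"
    using T I(2) unfolding C1_curve_in_Ck_def by blast+
  then have cD: "continuous_on \<Omega> (D \<epsilon>)" and cD': "continuous_on \<Omega> D'"
    unfolding D_def D'_def by (simp_all only: continuous_on_jacobian_on)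
  have cE: "continuous_on \<Omega> (E \<epsilon>)"
    unfolding E_def[abs_def] using cD inv[OF I(2)] by (rule continuous_on_matrix_inv)
  \<comment> \<open>The product rule for uniform limits asks for bounded limit functions;
    compactness provides this for continuous ones.\<close>
  have bdd: "bounded (f ` \<Omega>)" if "continuous_on \<Omega> f" for f :: "real ^ 'n \<Rightarrow> real ^ 'n ^ 'n"
    using compact_continuous_image[OF that \<Omega>(1)] by (rule compact_imp_bounded)
  note mult = bounded_bilinear.bounded_uniform_limit[OF bounded_bilinear_matrix_mult]
  note transp = bounded_linear.uniform_limit[OF bounded_linear_transpose]
  have Q: "uniform_limit \<Omega> Q D' (at \<epsilon>)"
    unfolding Q_def[abs_def] D_def D'_def using \<Omega> T I by (rule C1_curve_uniform_limit_jacobian)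
  \<comment> \<open>Convergence of the Jacobians is recovered from that of their quotients:
    \<open>D \<delta>\<close> is \<open>D \<epsilon>\<close> plus
    \<open>\<delta> - \<epsilon>\<close> times \<open>Q \<delta>\<close>.\<close>
  have D: "uniform_limit \<Omega> D (D \<epsilon>) (at \<epsilon>)"
  proof -
    have "uniform_limit \<Omega> (\<lambda>\<delta> x. \<delta> - \<epsilon>) (\<lambda>x. 0) (at \<epsilon>)"
    proof (rule uniform_limitI)
      fix r :: real assume r: "r > 0"
      have "((\<lambda>\<delta>. \<delta> - \<epsilon>) \<longlongrightarrow> 0) (at \<epsilon>)" by (auto intro!: tendsto_eq_intros)
      from tendstoD[OF this r]
      show "\<forall>\<^sub>F \<delta> in at \<epsilon>. \<forall>x\<in>\<Omega>. dist (\<delta> - \<epsilon>) 0 < r" by eventually_elim simp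
    qed
    then have "uniform_limit \<Omega> (\<lambda>\<delta> x. D \<epsilon> x + (\<delta> - \<epsilon>) *\<^sub>R Q \<delta> x) (\<lambda>x. D \<epsilon> x + 0 *\<^sub>R D' x) (at \<epsilon>)"
      using Q bdd[OF cD']
      by (intro uniform_limit_add uniform_limit_const
          bounded_bilinear.bounded_uniform_limit[OF bounded_bilinear_scaleR])
        (auto intro: finite_imp_bounded finite_subset[of _ "{0}"])
    moreover have "\<forall>\<^sub>F \<delta> in at \<epsilon>. \<forall>x\<in>\<Omega>. D \<epsilon> x + (\<delta> - \<epsilon>) *\<^sub>R Q \<delta> x = D \<delta> x"
      using ne by eventually_elim (simp add: Q_def)
    ultimately show ?thesis by (simp cong: uniform_limit_cong)
  qed
  have E: "uniform_limit \<Omega> E (E \<epsilon>) (at \<epsilon>)"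
    unfolding E_def[abs_def]
  proof (rule uniform_limit_matrix_inv[OF D])
    show "\<forall>\<^sub>F \<delta> in at \<epsilon>. \<forall>x\<in>\<Omega>. invertible (D \<delta> x)"
      using evI by eventually_elim (simp add: inv)
    show "bounded ((\<lambda>x. matrix_inv (D \<epsilon> x)) ` \<Omega>)" using bdd[OF cE] by (simp add: E_def)
  qed (rule inv[OF I(2)])
  have R: "uniform_limit \<Omega> R R' (at \<epsilon>)"
    unfolding R_def[abs_def] R'_def[abs_def]
    by (intro uniform_limit_uminus mult E Q uniform_limit_const bdd continuous_on_matrix_mult cE cD')
  have cR': "continuous_on \<Omega> R'"
    unfolding R'_def[abs_def] by (intro continuous_on_minus continuous_on_matrix_mult cE cD')
  have lim: "uniform_limit \<Omega>
      (\<lambda>\<delta> x. (1 / 2) *\<^sub>R (R \<delta> x ** transpose (E \<delta> x) + E \<epsilon> x ** transpose (R \<delta> x)))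
      (\<lambda>x. (1 / 2) *\<^sub>R (R' x ** transpose (E \<epsilon> x) + E \<epsilon> x ** transpose (R' x))) (at \<epsilon>)"
    by (intro bounded_linear.uniform_limit[OF bounded_linear_scaleR_right] uniform_limit_add mult
        transp R E uniform_limit_const bdd continuous_on_transpose cR' cE)
  \<comment> \<open>Discrete product rule: the mixed term
    \<open>E \<epsilon> x ** transpose (E \<delta> x)\<close> is subtracted and added, and the
    summand \<open>mat 1\<close> cancels.\<close>
  have eq: "(1 / 2) *\<^sub>R (R \<delta> x ** transpose (E \<delta> x) + E \<epsilon> x ** transpose (R \<delta> x))
      = (dyn_matrix \<Omega> (T \<delta>) x - dyn_matrix \<Omega> (T \<epsilon>) x) /\<^sub>R (\<delta> - \<epsilon>)"
    if \<delta>: "\<delta> \<in> I" and x: "x \<in> \<Omega>" for \<delta> x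
  proof -
    have R: "R \<delta> x = (E \<delta> x - E \<epsilon> x) /\<^sub>R (\<delta> - \<epsilon>)"
      unfolding R_def Q_def E_def
      by (simp add: matrix_inv_diff inv \<delta> x I matrix_scalar_ac scalar_matrix_assoc)
    have "R \<delta> x ** transpose (E \<delta> x) + E \<epsilon> x ** transpose (R \<delta> x)
        = ((E \<delta> x - E \<epsilon> x) ** transpose (E \<delta> x) + E \<epsilon> x ** transpose (E \<delta> x - E \<epsilon> x)) /\<^sub>R (\<delta> - \<epsilon>)"
      unfolding R
      by (simp add: transpose_scalar matrix_scalar_ac scalar_matrix_assoc[symmetric] scaleR_add_right)
    also have "(E \<delta> x - E \<epsilon> x) ** transpose (E \<delta> x) + E \<epsilon> x ** transpose (E \<delta> x - E \<epsilon> x)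
        = E \<delta> x ** transpose (E \<delta> x) - E \<epsilon> x ** transpose (E \<epsilon> x)"
      by (simp add: bounded_bilinear.diff_left[OF bounded_bilinear_matrix_mult]
          bounded_bilinear.diff_right[OF bounded_bilinear_matrix_mult]
          linear_diff[OF bounded_linear.linear[OF bounded_linear_transpose]])
    finally have *: "R \<delta> x ** transpose (E \<delta> x) + E \<epsilon> x ** transpose (R \<delta> x)
        = (E \<delta> x ** transpose (E \<delta> x) - E \<epsilon> x ** transpose (E \<epsilon> x)) /\<^sub>R (\<delta> - \<epsilon>)" .
    have "dyn_matrix \<Omega> (T \<delta>) x - dyn_matrix \<Omega> (T \<epsilon>) x
        = (1 / 2) *\<^sub>R (E \<delta> x ** transpose (E \<delta> x) - E \<epsilon> x ** transpose (E \<epsilon> x))"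
      using inv[OF \<delta> x] inv[OF I(2) x]
      by (simp add: dyn_matrix_eq D_def E_def scaleR_diff_right scaleR_add_right)
    then show ?thesis by (simp add: * mult.commute)
  qed
  \<comment> \<open>The second summand is the transpose of the first, which is where the symmetric
    part comes from.\<close>
  have eq': "(1 / 2) *\<^sub>R (R' x ** transpose (E \<epsilon> x) + E \<epsilon> x ** transpose (R' x))
      = dyn_matrix_deriv \<Omega> (T \<epsilon>) (T' \<epsilon>) x" for x
    unfolding R'_def dyn_matrix_deriv_def sym_part_def E_def D_def D'_def
    by (simp add: matrix_transpose_mul matrix_mul_assoc
        bounded_bilinear.minus_left[OF bounded_bilinear_matrix_mult]
        bounded_bilinear.minus_right[OF bounded_bilinear_matrix_mult]
        linear_neg[OF bounded_linear.linear[OF bounded_linear_transpose]] algebra_simps)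
  show ?thesis
    using lim unfolding eq'
    by (rule uniform_limit_cong[THEN iffD1, rotated -1])
      (use evI in \<open>auto elim!: eventually_mono simp: eq\<close>)
qed

section \<open>Weak derivative of the dynamic form at zero\<close>

theorem proposition1:
  fixes \<Omega> :: "(real ^ 'n) set"
    and T Tdot :: "real \<Rightarrow> real ^ 'n \<Rightarrow> real ^ 'n"
    and \<epsilon>0 :: real
    and H :: "(real ^ 'n \<Rightarrow> real) set"
  assumes "compact \<Omega>" and "connected \<Omega>" and "\<Omega> \<noteq> {}" and "smooth_boundary \<Omega>"
    and "\<epsilon>0 > 0"
    and "\<And>\<epsilon>. \<epsilon> \<in> {-\<epsilon>0<..<\<epsilon>0} \<Longrightarrow> Ck_diffeo_onto_image 2 \<Omega> (T \<epsilon>)"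
    and "\<And>\<epsilon>. \<epsilon> \<in> {-\<epsilon>0<..<\<epsilon>0} \<Longrightarrow> volume_preserving \<Omega> (T \<epsilon>)"
    and "C1_curve_in_Ck 2 \<Omega> {-\<epsilon>0<..<\<epsilon>0} T Tdot"
    and "H = H1 \<Omega> \<or> H = H1_0 \<Omega>"
  shows "\<forall>\<psi>\<in>H. \<forall>\<phi>\<in>H.
    ((\<lambda>\<epsilon>. (dyn_form \<Omega> (T \<epsilon>) \<psi> \<phi> - dyn_form \<Omega> (T 0) \<psi> \<phi>) / \<epsilon>)
      \<longlongrightarrow> dyn_form_deriv \<Omega> (T 0) (Tdot 0) \<psi> \<phi>) (at 0)"
proof (intro ballI)
  fix \<psi> \<phi> assume "\<psi> \<in> H" "\<phi> \<in> H"
  \<comment> \<open>The Dirichlet space lies inside \<open>H1\<close>, so both boundary conditions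
    are treated at once.\<close>
  then have H1: "\<psi> \<in> H1 \<Omega>" "\<phi> \<in> H1 \<Omega>" using assms(9) by (auto simp: H1_0_def)
  let ?I = "{-\<epsilon>0<..<\<epsilon>0}"
  have I: "open ?I" "0 \<in> ?I" using assms(5) by auto
  have cones: "has_inner_cones \<Omega>" using assms(4) by (rule has_inner_cones_smooth_boundary)
  have diffeo: "Ck_diffeo_onto_image (Suc 1) \<Omega> (T \<epsilon>)" if "\<epsilon> \<in> ?I" for \<epsilon>
    using assms(6)[OF that] by (simp add: numeral_2_eq_2)
  have curve: "C1_curve_in_Ck (Suc 1) \<Omega> ?I T Tdot" using assms(8) by (simp add: numeral_2_eq_2)
  have cont: "continuous_on \<Omega> (dyn_matrix \<Omega> (T \<epsilon>))" if "\<epsilon> \<in> ?I" for \<epsilon>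
    using cones diffeo[OF that] by (rule continuous_on_dyn_matrix)
  have evI: "\<forall>\<^sub>F \<epsilon> in at 0. \<epsilon> \<in> ?I" using I by (rule eventually_at_in_open')
  have "((\<lambda>\<epsilon>. gradient_form \<Omega> (\<lambda>x. (dyn_matrix \<Omega> (T \<epsilon>) x - dyn_matrix \<Omega> (T 0) x) /\<^sub>R \<epsilon>) \<psi> \<phi>)
      \<longlongrightarrow> gradient_form \<Omega> (dyn_matrix_deriv \<Omega> (T 0) (Tdot 0)) \<psi> \<phi>) (at 0)"
  proof (rule tendsto_gradient_form[OF assms(1) _ _ _ H1])
    show "uniform_limit \<Omega> (\<lambda>\<epsilon> x. (dyn_matrix \<Omega> (T \<epsilon>) x - dyn_matrix \<Omega> (T 0) x) /\<^sub>R \<epsilon>)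
        (dyn_matrix_deriv \<Omega> (T 0) (Tdot 0)) (at 0)"
      using uniform_limit_dyn_matrix_diff_quotient[OF assms(1) cones diffeo curve I] by simp
    show "\<forall>\<^sub>F \<epsilon> in at 0. continuous_on \<Omega>
        (\<lambda>x. (dyn_matrix \<Omega> (T \<epsilon>) x - dyn_matrix \<Omega> (T 0) x) /\<^sub>R \<epsilon>)"
      using evI by eventually_elim (intro continuous_intros cont I(2))
    show "continuous_on \<Omega> (dyn_matrix_deriv \<Omega> (T 0) (Tdot 0))"
      using curve I(2)
      by (intro continuous_on_dyn_matrix_deriv[OF cones diffeo]) (auto simp: C1_curve_in_Ck_def)
  qed
  \<comment> \<open>The two quotients are compared only for parameters in the interval, where
    continuity of the coefficients gives the integrability needed to combine the integrals.\<close>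
  moreover have "\<forall>\<^sub>F \<epsilon> in at 0.
      gradient_form \<Omega> (\<lambda>x. (dyn_matrix \<Omega> (T \<epsilon>) x - dyn_matrix \<Omega> (T 0) x) /\<^sub>R \<epsilon>) \<psi> \<phi>
      = (dyn_form \<Omega> (T \<epsilon>) \<psi> \<phi> - dyn_form \<Omega> (T 0) \<psi> \<phi>) / \<epsilon>"
    using evI
    by eventually_elim
      (simp only: dyn_form_def gradient_form_diff_quotient[OF assms(1) cont cont[OF I(2)] H1])
  ultimately show "((\<lambda>\<epsilon>. (dyn_form \<Omega> (T \<epsilon>) \<psi> \<phi> - dyn_form \<Omega> (T 0) \<psi> \<phi>) / \<epsilon>)
      \<longlongrightarrow> dyn_form_deriv \<Omega> (T 0) (Tdot 0) \<psi> \<phi>) (at 0)"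
    unfolding dyn_form_deriv_def by (rule Lim_transform_eventually)
qed

end
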